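(* (a) There exist flip pairs $(A,J)$ and $(B,K)$ such that there is a $D_\infty$-shift equivalence between $(A,J)$ and $(B,K)$, but the corresponding $D_\infty$-topological Markov chains $(\mathsf{X}_A,\sigma_A,\varphi_{A,J})$ and $(\mathsf{X}_B,\sigma_B,\varphi_{B,K})$ do not have the same Lind zeta function. (b) There exist flip pairs $(A,J)$ and $(B,K)$ such that $(\mathsf{X}_A,\sigma_A,\varphi_{A,J})$ and $(\mathsf{X}_B,\sigma_B,\varphi_{B,K})$ have the same Lind zeta function, but there is no $D_\infty$-shift equivalence (of any lag) from $(A,J)$ to $(B,K)$.
   Context: Flip pairs. Let $\mathcal{A}$ be a finite set. A pair $(A,J)$ of zero-one $\mathcal{A}\times\mathcal{A}$ matrices is a flip pair if $JA=A^{\mathsf T}J$ and $J^2=I$. There is then a unique map $\tau_J:\mathcal{A}\to\mathcal{A}$ with $J(a,b)=1$ if and only if $\tau_J(a)=b$, and $\tau_J^2=\mathrm{id}$. Let $\mathsf{X}_A=\{x\in\mathcal{A}^{\mathbb Z}: A(x_i,x_{i+1})=1\ \text{for all } i\in\mathbb{Z}\}$, let $\sigma_A$ be the restriction to $\mathsf{X}_A$ of the shift map $\sigma(x)_i=x_{i+1}$, and let $\varphi_{A,J}:\mathsf{X}_A\to\mathsf{X}_A$ be given by $\varphi_{A,J}(x)_i=\tau_J(x_{-i})$. Then $\varphi_{A,J}$ is a homeomorphism with $\varphi_{A,J}\circ\sigma_A=\sigma_A^{-1}\circ\varphi_{A,J}$ and $\varphi_{A,J}^2=\mathrm{id}$.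 The triple $(\mathsf{X}_A,\sigma_A,\varphi_{A,J})$ is the $D_\infty$-topological Markov chain determined by $(A,J)$. $D_\infty$-shift equivalence. Let $(A,J)$ and $(B,K)$ be flip pairs indexed by finite sets $\mathcal{A}$ and $\mathcal{B}$, and let $l$ be a positive integer. A $D_\infty$-shift equivalence of lag $l$ from $(A,J)$ to $(B,K)$ is a pair $(R,S)$ of nonnegative integral matrices ($R$ is $\mathcal{A}\times\mathcal{B}$, $S$ is $\mathcal{B}\times\mathcal{A}$) satisfying $A^l=RS$, $B^l=SR$, $AR=RB$ and $S=KR^{\mathsf T}J$. There is a $D_\infty$-shift equivalence between two flip pairs if there is one of some lag $l\ge 1$. Lind zeta function. For an action $\alpha$ of a group $G$ on a set $X$, let $\mathcal{F}$ be the set of finite index subgroups of $G$, and for $H\in\mathcal{F}$ let $p_H(\alpha)=|\{x\in X:\alpha(h,x)=x\ \text{for all } h\in H\}|$. The Lind zeta function of $\alpha$ is the formal power series $\zeta_\alpha(t)=\exp\left(\sum_{H\in\mathcal{F}}\frac{p_H(\alpha)}{|G/H|}t^{|G/H|}\right)$. Let $D_\infty=\langle a,b: ab=ba^{-1},\ b^2=1\rangle$. The Lind zeta function of $(\mathsf{X}_A,\sigma_A,\varphi_{A,J})$ is that of the $D_\infty$-action $\alpha$ on $\mathsf{X}_A$ determined by $\alpha(a,x)=\sigma_A(x)$ and $\alpha(b,x)=\varphi_{A,J}(x)$. *)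

theory Defs
  imports
    Jordan_Normal_Form.Matrix
    "HOL-Algebra.Group_Action"
    "HOL-Computational_Algebra.Formal_Power_Series"
begin

section \<open>Flip pairs and their Markov chains\<close>

text \<open>
  The finite index set of a square matrix is \<open>{0..<n}\<close>, where \<open>n\<close> is its dimension.
  Nonnegative integral matrices are matrices over \<^typ>\<open>nat\<close>.
\<close>

definition flip_pair :: "nat mat \<Rightarrow> nat mat \<Rightarrow> bool" where
  "flip_pair A J \<longleftrightarrow>
     square_mat A \<and> J \<in> carrier_mat (dim_row A) (dim_row A) \<and>
     elements_mat A \<subseteq> {0, 1} \<and> elements_mat J \<subseteq> {0, 1} \<and>
     J * A = transpose_mat A * J \<and> J * J = 1\<^sub>m (dim_row A)"

definition flip_symbol :: "nat mat \<Rightarrow> nat \<Rightarrow> nat" where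
  "flip_symbol J a = (THE b. b < dim_row J \<and> J $$ (a, b) = 1)"

definition markov_shift :: "nat mat \<Rightarrow> (int \<Rightarrow> nat) set" where
  "markov_shift A =
     {x. (\<forall>i. x i < dim_row A) \<and> (\<forall>i. A $$ (x i, x (i + 1)) = 1)}"

definition shift_map :: "nat mat \<Rightarrow> (int \<Rightarrow> nat) \<Rightarrow> (int \<Rightarrow> nat)" where
  "shift_map A = (\<lambda>x\<in>markov_shift A. \<lambda>i. x (i + 1))"

definition flip_map :: "nat mat \<Rightarrow> nat mat \<Rightarrow> (int \<Rightarrow> nat) \<Rightarrow> (int \<Rightarrow> nat)" where
  "flip_map A J = (\<lambda>x\<in>markov_shift A. \<lambda>i. flip_symbol J (x (- i)))"


section \<open>\<open>D\<^sub>\<infinity>\<close>-shift equivalence\<close>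

definition dinf_shift_equivalence ::
  "nat \<Rightarrow> nat mat \<Rightarrow> nat mat \<Rightarrow> nat mat \<Rightarrow> nat mat \<Rightarrow> nat mat \<Rightarrow> nat mat \<Rightarrow> bool" where
  "dinf_shift_equivalence l A J B K R S \<longleftrightarrow>
     0 < l \<and>
     R \<in> carrier_mat (dim_row A) (dim_row B) \<and> S \<in> carrier_mat (dim_row B) (dim_row A) \<and>
     A ^\<^sub>m l = R * S \<and> B ^\<^sub>m l = S * R \<and> A * R = R * B \<and>
     S = K * transpose_mat R * J"

definition dinf_shift_equivalent ::
  "nat mat \<Rightarrow> nat mat \<Rightarrow> nat mat \<Rightarrow> nat mat \<Rightarrow> bool" where
  "dinf_shift_equivalent A J B K \<longleftrightarrow> (\<exists>l R S. dinf_shift_equivalence l A J B K R S)"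


section \<open>The infinite dihedral group\<close>

text \<open>
  The pair \<open>(i, e)\<close> stands for \<open>a\<^sup>i\<close> if \<open>e\<close> is \<^const>\<open>False\<close> and for \<open>a\<^sup>i b\<close> if \<open>e\<close> is
  \<^const>\<open>True\<close>. That this is the group presented by \<open>a\<close>, \<open>b\<close> with \<open>a b = b a\<^sup>-\<^sup>1\<close> and
  \<open>b\<^sup>2 = 1\<close> is the content of \<open>dinf_relations\<close>, \<open>dinf_lift_hom\<close> and
  \<open>dinf_lift_unique\<close> below.
\<close>

definition dinf :: "(int \<times> bool) monoid" where
  "dinf = \<lparr>carrier = UNIV,
           mult = (\<lambda>(i, e) (j, f). (if e then i - j else i + j, e \<noteq> f)),
           one = (0, False)\<rparr>"

definition dinf_a :: "int \<times> bool" where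
  "dinf_a = (1, False)"

definition dinf_b :: "int \<times> bool" where
  "dinf_b = (0, True)"

text \<open>The homomorphism to \<open>H\<close> with \<open>a \<mapsto> x\<close> and \<open>b \<mapsto> y\<close>.\<close>

definition dinf_lift :: "('h, 'm) monoid_scheme \<Rightarrow> 'h \<Rightarrow> 'h \<Rightarrow> int \<times> bool \<Rightarrow> 'h" where
  "dinf_lift H x y = (\<lambda>(i, e). x [^]\<^bsub>H\<^esub> i \<otimes>\<^bsub>H\<^esub> (if e then y else \<one>\<^bsub>H\<^esub>))"

lemma dinf_simps:
  "g \<in> carrier dinf"
  "(i, e) \<otimes>\<^bsub>dinf\<^esub> (j, f) = (if e then i - j else i + j, e \<noteq> f)"
  "\<one>\<^bsub>dinf\<^esub> = (0, False)"
  by (simp_all add: dinf_def)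

lemma group_dinf: "group dinf"
proof (rule groupI)
  fix x y z :: "int \<times> bool"
  obtain i e where x: "x = (i, e)" by (cases x)
  obtain j f where y: "y = (j, f)" by (cases y)
  obtain k g where z: "z = (k, g)" by (cases z)
  show "x \<otimes>\<^bsub>dinf\<^esub> y \<otimes>\<^bsub>dinf\<^esub> z = x \<otimes>\<^bsub>dinf\<^esub> (y \<otimes>\<^bsub>dinf\<^esub> z)"
    unfolding x y z by (cases e; cases f) (simp_all add: dinf_simps)
  show "\<one>\<^bsub>dinf\<^esub> \<otimes>\<^bsub>dinf\<^esub> x = x"
    unfolding x by (simp add: dinf_simps)
  show "\<exists>y\<in>carrier dinf. y \<otimes>\<^bsub>dinf\<^esub> x = \<one>\<^bsub>dinf\<^esub>"
    unfolding x
    by (rule bexI[of _ "(if e then i else - i, e)"]) (simp_all add: dinf_simps)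
qed (simp_all add: dinf_simps)

lemma dinf_relations:
  "dinf_a \<otimes>\<^bsub>dinf\<^esub> dinf_b = dinf_b \<otimes>\<^bsub>dinf\<^esub> m_inv dinf dinf_a"
  "dinf_b \<otimes>\<^bsub>dinf\<^esub> dinf_b = \<one>\<^bsub>dinf\<^esub>"
proof -
  have "m_inv dinf dinf_a = (-1, False)"
    by (rule group.inv_equality[OF group_dinf]) (auto simp: dinf_simps dinf_a_def)
  then show "dinf_a \<otimes>\<^bsub>dinf\<^esub> dinf_b = dinf_b \<otimes>\<^bsub>dinf\<^esub> m_inv dinf dinf_a"
    by (simp add: dinf_simps dinf_a_def dinf_b_def)
qed (simp add: dinf_simps dinf_b_def)

lemma dinf_a_pow: "dinf_a [^]\<^bsub>dinf\<^esub> (i :: int) = (i, False)"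
proof -
  interpret group dinf by (rule group_dinf)
  have nat: "dinf_a [^]\<^bsub>dinf\<^esub> (n :: nat) = (int n, False)" for n
    by (induction n) (auto simp: dinf_simps dinf_a_def)
  have inv: "m_inv dinf (int n, False) = (- int n, False)" for n
    by (rule inv_equality) (auto simp: dinf_simps)
  show ?thesis
    using inv[of "nat (- i)"] by (auto simp: int_pow_def2 nat)
qed

lemma dinf_lift_hom:
  assumes H: "group H" and x: "x \<in> carrier H" and y: "y \<in> carrier H"
    and xy: "x \<otimes>\<^bsub>H\<^esub> y = y \<otimes>\<^bsub>H\<^esub> m_inv H x" and yy: "y \<otimes>\<^bsub>H\<^esub> y = \<one>\<^bsub>H\<^esub>"
  shows "dinf_lift H x y \<in> hom dinf H"
    and "dinf_lift H x y dinf_a = x" and "dinf_lift H x y dinf_b = y"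
proof -
  interpret group H by (rule H)
  have inv_y: "m_inv H y = y"
    using yy y by (simp add: inv_equality)
  have conj1: "y \<otimes>\<^bsub>H\<^esub> x \<otimes>\<^bsub>H\<^esub> y = m_inv H x"
    by (metis xy yy x y m_assoc m_closed inv_closed l_one)
  have comm: "y \<otimes>\<^bsub>H\<^esub> x [^]\<^bsub>H\<^esub> (j :: int) = x [^]\<^bsub>H\<^esub> (- j) \<otimes>\<^bsub>H\<^esub> y" for j
  proof -
    have n: "y \<otimes>\<^bsub>H\<^esub> x [^]\<^bsub>H\<^esub> (n :: nat) = m_inv H x [^]\<^bsub>H\<^esub> n \<otimes>\<^bsub>H\<^esub> y" for n
    proof (induction n)
      case (Suc n)
      have "y \<otimes>\<^bsub>H\<^esub> x [^]\<^bsub>H\<^esub> Suc n = m_inv H x [^]\<^bsub>H\<^esub> n \<otimes>\<^bsub>H\<^esub> (y \<otimes>\<^bsub>H\<^esub> x)"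
        using Suc x y by (simp flip: m_assoc)
      also have "y \<otimes>\<^bsub>H\<^esub> x = m_inv H x \<otimes>\<^bsub>H\<^esub> y"
        using conj1 by (metis inv_y x y inv_solve_right m_closed inv_closed)
      finally show ?case using x y by (simp add: m_assoc)
    qed (use x y in auto)
    have n': "y \<otimes>\<^bsub>H\<^esub> m_inv H x [^]\<^bsub>H\<^esub> (n :: nat) = x [^]\<^bsub>H\<^esub> n \<otimes>\<^bsub>H\<^esub> y" for n
    proof (induction n)
      case (Suc n)
      have "y \<otimes>\<^bsub>H\<^esub> m_inv H x [^]\<^bsub>H\<^esub> Suc n = x [^]\<^bsub>H\<^esub> n \<otimes>\<^bsub>H\<^esub> (y \<otimes>\<^bsub>H\<^esub> m_inv H x)"
        using Suc x y by (simp flip: m_assoc)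
      also have "y \<otimes>\<^bsub>H\<^esub> m_inv H x = x \<otimes>\<^bsub>H\<^esub> y" by (simp add: xy)
      finally show ?case using x y by (simp add: m_assoc)
    qed (use x y in auto)
    show ?thesis
    proof (cases j rule: int_cases2)
      case (nonneg k)
      then show ?thesis using n[of k] x by (simp add: int_pow_int int_pow_neg nat_pow_inv)
    next
      case (nonpos k)
      then show ?thesis using n'[of k] x by (simp add: int_pow_int int_pow_neg nat_pow_inv)
    qed
  qed
  show "dinf_lift H x y \<in> hom dinf H"
  proof (rule homI)
    fix g assume "g \<in> carrier dinf"
    show "dinf_lift H x y g \<in> carrier H"
      using x y by (auto simp: dinf_lift_def split: prod.splits)
  next
    fix g h :: "int \<times> bool"
    obtain i e where g: "g = (i, e)" by (cases g)
    obtain j f where h: "h = (j, f)" by (cases h)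
    have 1: "x [^]\<^bsub>H\<^esub> i \<otimes>\<^bsub>H\<^esub> y \<otimes>\<^bsub>H\<^esub> x [^]\<^bsub>H\<^esub> j = x [^]\<^bsub>H\<^esub> (i - j) \<otimes>\<^bsub>H\<^esub> y"
      using x y comm[of j] int_pow_mult[OF x, of i "- j"] by (simp add: m_assoc)
    have 2: "x [^]\<^bsub>H\<^esub> i \<otimes>\<^bsub>H\<^esub> y \<otimes>\<^bsub>H\<^esub> (x [^]\<^bsub>H\<^esub> j \<otimes>\<^bsub>H\<^esub> y) = x [^]\<^bsub>H\<^esub> (i - j)"
      using x y 1 yy by (metis m_assoc int_pow_closed m_closed r_one)
    show "dinf_lift H x y (g \<otimes>\<^bsub>dinf\<^esub> h) = dinf_lift H x y g \<otimes>\<^bsub>H\<^esub> dinf_lift H x y h"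
      using x y 1 2 unfolding g h
      by (cases e; cases f) (simp_all add: dinf_lift_def dinf_simps int_pow_mult m_assoc)
  qed
  show "dinf_lift H x y dinf_a = x" "dinf_lift H x y dinf_b = y"
    using x y by (simp_all add: dinf_lift_def dinf_a_def dinf_b_def)
qed

lemma dinf_lift_unique:
  assumes H: "group H" and h: "h \<in> hom dinf H" "h dinf_a = x" "h dinf_b = y"
  shows "h = dinf_lift H x y"
proof
  fix g :: "int \<times> bool"
  interpret group_hom dinf H h
    using H h group_dinf by (simp add: group_hom_def group_hom_axioms_def)
  obtain i e where g: "g = (i, e)" by (cases g)
  have car: "z \<in> carrier dinf" for z by (simp add: dinf_simps)
  have pow: "h (i, False) = x [^]\<^bsub>H\<^esub> i"
    using hom_int_pow[of dinf_a i] h car by (simp add: dinf_a_pow)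
  have b: "h (i, True) = x [^]\<^bsub>H\<^esub> i \<otimes>\<^bsub>H\<^esub> y"
    using hom_mult[of "(i, False)" dinf_b] pow h car by (simp add: dinf_simps dinf_b_def)
  have "x [^]\<^bsub>H\<^esub> i \<in> carrier H" using pow car hom_closed by metis
  then show "h g = dinf_lift H x y g"
    using pow b g by (simp add: dinf_lift_def)
qed


section \<open>The Lind zeta function\<close>

definition finite_index :: "('g, 'm) monoid_scheme \<Rightarrow> 'g set \<Rightarrow> bool" where
  "finite_index G H \<longleftrightarrow> subgroup H G \<and> finite (rcosets\<^bsub>G\<^esub> H)"

definition fixed_points :: "('g \<Rightarrow> 'x \<Rightarrow> 'x) \<Rightarrow> 'x set \<Rightarrow> 'g set \<Rightarrow> 'x set" where
  "fixed_points \<alpha> X H = {x \<in> X. \<forall>h\<in>H. \<alpha> h x = x}"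

text \<open>
  The sum over all finite index subgroups, grouped by index into the coefficients of a formal power
  series. It is meaningful only if there are finitely many subgroups of each finite index and
  each of them has finitely many fixed points; \<open>finite_dinf_subgroups\<close> and
  \<open>finite_fixed_points_dinf_action\<close> below establish this for the actions at hand.
  The constant coefficient is \<open>0\<close>, so composition with the exponential series is legitimate.
\<close>

definition lind_zeta_exponent ::
  "('g, 'm) monoid_scheme \<Rightarrow> ('g \<Rightarrow> 'x \<Rightarrow> 'x) \<Rightarrow> 'x set \<Rightarrow> rat fps" where
  "lind_zeta_exponent G \<alpha> X = Abs_fps (\<lambda>n.
     \<Sum>H | finite_index G H \<and> card (rcosets\<^bsub>G\<^esub> H) = n.
       of_nat (card (fixed_points \<alpha> X H)) / of_nat n)"

definition lind_zeta ::
  "('g, 'm) monoid_scheme \<Rightarrow> ('g \<Rightarrow> 'x \<Rightarrow> 'x) \<Rightarrow> 'x set \<Rightarrow> rat fps" where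
  "lind_zeta G \<alpha> X = fps_exp 1 oo lind_zeta_exponent G \<alpha> X"

definition dinf_action :: "nat mat \<Rightarrow> nat mat \<Rightarrow> int \<times> bool \<Rightarrow> (int \<Rightarrow> nat) \<Rightarrow> (int \<Rightarrow> nat)" where
  "dinf_action A J = dinf_lift (BijGroup (markov_shift A)) (shift_map A) (flip_map A J)"

definition markov_lind_zeta :: "nat mat \<Rightarrow> nat mat \<Rightarrow> rat fps" where
  "markov_lind_zeta A J = lind_zeta dinf (dinf_action A J) (markov_shift A)"


section \<open>Well-definedness\<close>

lemma flip_pair_symbol:
  assumes "flip_pair A J" "a < dim_row A"
  shows "\<exists>!b. b < dim_row A \<and> J $$ (a, b) = 1"
    and "flip_symbol J a < dim_row A"
    and "b < dim_row A \<Longrightarrow> J $$ (a, b) = (if b = flip_symbol J a then 1 else 0)"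
    and "flip_symbol J (flip_symbol J a) = a"
proof -
  let ?n = "dim_row A"
  have J: "J \<in> carrier_mat ?n ?n" and JJ: "J * J = 1\<^sub>m ?n" and el: "elements_mat J \<subseteq> {0, 1}"
    using assms by (auto simp: flip_pair_def)
  have dim: "dim_row J = ?n" "dim_col J = ?n" using J by auto
  have J01: "J $$ (i, j) = 0 \<or> J $$ (i, j) = 1" if "i < ?n" "j < ?n" for i j
    using el that J elements_matI[OF J that refl] by auto
  have prod: "(\<Sum>k<?n. J $$ (i, k) * J $$ (k, j)) = (if i = j then 1 else 0)"
    if "i < ?n" "j < ?n" for i j
  proof -
    have "(J * J) $$ (i, j) = (\<Sum>k<?n. J $$ (i, k) * J $$ (k, j))"
      using that dim by (auto simp: scalar_prod_def lessThan_atLeast0 intro!: sum.cong)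
    then show ?thesis using JJ that by simp
  qed
  have sym: "J $$ (k, i) = 1 \<and> (\<forall>k'<?n. J $$ (i, k') = 1 \<longrightarrow> k' = k)"
    if "i < ?n" "k < ?n" "J $$ (i, k) = 1" for i k
  proof -
    have bk: "J $$ (k, j) = 0" if j: "j < ?n" "j \<noteq> i" for j
    proof -
      have "(\<Sum>k<?n. J $$ (i, k) * J $$ (k, j)) = 0" using prod[of i j] that \<open>i < ?n\<close> by auto
      then have "J $$ (i, k) * J $$ (k, j) = 0" using \<open>k < ?n\<close> by simp
      then show ?thesis using \<open>J $$ (i, k) = 1\<close> by simp
    qed
    have "(\<Sum>j<?n. J $$ (k, j) * J $$ (j, k)) = J $$ (k, i) * J $$ (i, k)"
      using \<open>i < ?n\<close> bk
      by (subst sum.remove[of _ i]) (auto intro!: sum.neutral)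
    then have ki: "J $$ (k, i) = 1" using prod[of k k] that by simp
    have "k' = k" if k': "k' < ?n" "J $$ (i, k') = 1" for k'
    proof (rule ccontr)
      assume "k' \<noteq> k"
      then have "(\<Sum>j<?n. J $$ (k, j) * J $$ (j, k')) = 0"
        using prod[of k k'] k' \<open>k < ?n\<close> by auto
      then have "J $$ (k, i) * J $$ (i, k') = 0" using \<open>i < ?n\<close> by simp
      then show False using ki k' by simp
    qed
    with ki show ?thesis by blast
  qed
  have ex: "\<exists>k<?n. J $$ (i, k) = 1" if i: "i < ?n" for i
  proof (rule ccontr)
    assume "\<not> ?thesis"
    then have "\<forall>k<?n. J $$ (i, k) = 0" using J01 i by blast
    then show False using prod[of i i] i by simp
  qed
  have uniq: "\<exists>!b. b < ?n \<and> J $$ (i, b) = 1" if i: "i < ?n" for i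
    using ex[OF i] sym[OF i] by blast
  have fs: "flip_symbol J i < ?n \<and> J $$ (i, flip_symbol J i) = 1" if i: "i < ?n" for i
    using theI'[OF uniq[OF i]] dim by (simp add: flip_symbol_def)
  show "\<exists>!b. b < ?n \<and> J $$ (a, b) = 1" using uniq assms by blast
  show "flip_symbol J a < ?n" using fs assms by blast
  show "J $$ (a, b) = (if b = flip_symbol J a then 1 else 0)" if "b < ?n"
    using that fs[OF assms(2)] J01[OF assms(2) that] uniq[OF assms(2)] by auto
  show "flip_symbol J (flip_symbol J a) = a"
    using fs sym assms(2) by metis
qed

lemma flip_pair_transition:
  assumes A: "flip_pair A J" and a: "a < dim_row A" and b: "b < dim_row A"
  shows "A $$ (flip_symbol J a, flip_symbol J b) = A $$ (b, a)"
proof -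
  let ?n = "dim_row A" and ?t = "flip_symbol J"
  have dim: "dim_row J = ?n" "dim_col J = ?n" "dim_col A = ?n" and JA: "J * A = transpose_mat A * J"
    using A by (auto simp: flip_pair_def)
  note t = flip_pair_symbol[OF A]
  have *: "A $$ (?t i, j) = A $$ (?t j, i)" if i: "i < ?n" and j: "j < ?n" for i j
  proof -
    have "(J * A) $$ (i, j) = (\<Sum>k<?n. J $$ (i, k) * A $$ (k, j))"
      using i j dim by (auto simp: scalar_prod_def lessThan_atLeast0 intro!: sum.cong)
    also have "\<dots> = (\<Sum>k<?n. if k = ?t i then A $$ (k, j) else 0)"
      using t(3)[OF i] by (intro sum.cong) auto
    also have "\<dots> = A $$ (?t i, j)" using t(2)[OF i] by simp
    finally have l: "(J * A) $$ (i, j) = A $$ (?t i, j)" .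
    have "(transpose_mat A * J) $$ (i, j) = (\<Sum>k<?n. A $$ (k, i) * J $$ (k, j))"
      using i j dim by (auto simp: scalar_prod_def lessThan_atLeast0 intro!: sum.cong)
    also have "\<dots> = (\<Sum>k<?n. if k = ?t j then A $$ (k, i) else 0)"
    proof (intro sum.cong refl)
      fix k assume "k \<in> {..<?n}"
      then have k: "k < ?n" by simp
      have "j = ?t k \<longleftrightarrow> k = ?t j" using t(4)[OF k] t(4)[OF j] by metis
      then show "A $$ (k, i) * J $$ (k, j) = (if k = ?t j then A $$ (k, i) else 0)"
        using t(3)[OF k j] by auto
    qed
    also have "\<dots> = A $$ (?t j, i)" using t(2)[OF j] by simp
    finally show ?thesis using l JA by simp
  qed
  show ?thesis using *[OF a t(2)[OF b]] t(4)[OF b] by simp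
qed

lemma markov_shiftD:
  assumes "x \<in> markov_shift A"
  shows "x i < dim_row A" and "j = i + 1 \<Longrightarrow> A $$ (x i, x j) = 1"
  using assms by (auto simp: markov_shift_def)

lemma markov_shiftI:
  assumes "\<And>i. x i < dim_row A" and "\<And>i. A $$ (x i, x (i + 1)) = 1"
  shows "x \<in> markov_shift A"
  using assms by (auto simp: markov_shift_def)

lemma shift_map_Bij: "shift_map A \<in> Bij (markov_shift A)"
proof -
  have "bij_betw (shift_map A) (markov_shift A) (markov_shift A)"
  proof (rule bij_betwI[where g = "\<lambda>x i. x (i - 1)"])
    show "shift_map A \<in> markov_shift A \<rightarrow> markov_shift A"
      by (auto simp: shift_map_def intro!: markov_shiftI markov_shiftD)
    show "(\<lambda>x i. x (i - 1)) \<in> markov_shift A \<rightarrow> markov_shift A"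
    proof
      fix x assume x: "x \<in> markov_shift A"
      show "(\<lambda>i. x (i - 1)) \<in> markov_shift A"
      proof (rule markov_shiftI)
        fix i
        show "x (i - 1) < dim_row A" using x by (rule markov_shiftD)
        show "A $$ (x (i - 1), x (i + 1 - 1)) = 1" using x by (rule markov_shiftD) simp
      qed
    qed
    then show "shift_map A (\<lambda>i. y (i - 1)) = y" if "y \<in> markov_shift A" for y
      using that by (auto simp: shift_map_def)
  qed (auto simp: shift_map_def)
  then show ?thesis by (simp add: Bij_def shift_map_def)
qed

lemma flip_map_closed:
  assumes A: "flip_pair A J" and x: "x \<in> markov_shift A"
  shows "flip_map A J x \<in> markov_shift A"
proof -
  have "A $$ (flip_symbol J (x (- i)), flip_symbol J (x (- i - 1))) = 1" for i
  proof -
    have "A $$ (x (- i - 1), x (- i - 1 + 1)) = 1" using x unfolding markov_shift_def by blast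
    then show ?thesis
      using flip_pair_transition[OF A, of "x (- i)" "x (- i - 1)"] x by (simp add: markov_shift_def)
  qed
  then show ?thesis
    using x flip_pair_symbol(2)[OF A] by (auto simp: flip_map_def markov_shift_def)
qed

lemma shift_map_apply: "x \<in> markov_shift A \<Longrightarrow> shift_map A x i = x (i + 1)"
  by (simp add: shift_map_def)

lemma flip_map_apply: "x \<in> markov_shift A \<Longrightarrow> flip_map A J x i = flip_symbol J (x (- i))"
  by (simp add: flip_map_def)

lemma flip_map_flip_map:
  assumes A: "flip_pair A J" and x: "x \<in> markov_shift A"
  shows "flip_map A J (flip_map A J x) = x"
proof
  fix i
  show "flip_map A J (flip_map A J x) i = x i"
    using flip_pair_symbol(4)[OF A markov_shiftD(1)[OF x]]
    by (simp add: flip_map_apply[OF x] flip_map_apply[OF flip_map_closed[OF A x]])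
qed

lemma flip_map_Bij:
  assumes A: "flip_pair A J"
  shows "flip_map A J \<in> Bij (markov_shift A)"
proof -
  have "bij_betw (flip_map A J) (markov_shift A) (markov_shift A)"
    by (rule bij_betwI[where g = "flip_map A J"])
       (auto intro: flip_map_closed[OF A] simp: flip_map_flip_map[OF A])
  then show ?thesis by (simp add: Bij_def flip_map_def)
qed

lemma group_action_dinf_action:
  assumes A: "flip_pair A J"
  shows "group_action dinf (markov_shift A) (dinf_action A J)"
    and "dinf_action A J dinf_a = shift_map A"
    and "dinf_action A J dinf_b = flip_map A J"
proof -
  let ?X = "markov_shift A" and ?s = "shift_map A" and ?f = "flip_map A J"
  let ?G = "BijGroup ?X"
  interpret G: group ?G by (rule group_BijGroup)
  have s: "?s \<in> carrier ?G" and f: "?f \<in> carrier ?G"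
    using shift_map_Bij flip_map_Bij[OF A] by (auto simp: BijGroup_def)
  have sc: "?s x \<in> ?X" if "x \<in> ?X" for x
    using that by (auto simp: shift_map_def intro!: markov_shiftI markov_shiftD)
  have G_eqI: "g = h"
    if "g \<in> carrier ?G" "h \<in> carrier ?G" "\<And>x. x \<in> ?X \<Longrightarrow> g x = h x" for g h
    using that by (intro extensionalityI[of _ ?X]) (auto simp: BijGroup_def Bij_def)
  have mult: "(g \<otimes>\<^bsub>?G\<^esub> h) x = g (h x)"
    if "g \<in> carrier ?G" "h \<in> carrier ?G" "x \<in> ?X" for g h x
    using that by (simp add: BijGroup_def compose_def)
  have one: "\<one>\<^bsub>?G\<^esub> x = x" if "x \<in> ?X" for x
    using that by (simp add: BijGroup_def)
  have ff: "?f \<otimes>\<^bsub>?G\<^esub> ?f = \<one>\<^bsub>?G\<^esub>"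
    using f by (intro G_eqI) (simp_all add: mult one flip_map_flip_map[OF A])
  have "?f \<otimes>\<^bsub>?G\<^esub> ?s \<otimes>\<^bsub>?G\<^esub> ?f \<otimes>\<^bsub>?G\<^esub> ?s = \<one>\<^bsub>?G\<^esub>"
  proof (rule G_eqI)
    fix x assume x: "x \<in> ?X"
    note c = sc[OF x] flip_map_closed[OF A sc[OF x]] sc[OF flip_map_closed[OF A sc[OF x]]]
    have "?f (?s (?f (?s x))) i = x i" for i
      using flip_pair_symbol(4)[OF A markov_shiftD(1)[OF x]]
      by (simp add: flip_map_apply c shift_map_apply x)
    then show "(?f \<otimes>\<^bsub>?G\<^esub> ?s \<otimes>\<^bsub>?G\<^esub> ?f \<otimes>\<^bsub>?G\<^esub> ?s) x = \<one>\<^bsub>?G\<^esub> x"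
      using x c s f by (simp add: mult one fun_eq_iff)
  qed (use s f in simp_all)
  then have "m_inv ?G ?s = ?f \<otimes>\<^bsub>?G\<^esub> ?s \<otimes>\<^bsub>?G\<^esub> ?f"
    using s f by (intro G.inv_equality) simp_all
  then have "?f \<otimes>\<^bsub>?G\<^esub> m_inv ?G ?s = (?f \<otimes>\<^bsub>?G\<^esub> ?f) \<otimes>\<^bsub>?G\<^esub> (?s \<otimes>\<^bsub>?G\<^esub> ?f)"
    using s f by (simp add: G.m_assoc)
  then have "?s \<otimes>\<^bsub>?G\<^esub> ?f = ?f \<otimes>\<^bsub>?G\<^esub> m_inv ?G ?s"
    using s f by (simp add: ff)
  note lift = dinf_lift_hom[OF G.group_axioms s f this ff]
  show "group_action dinf (markov_shift A) (dinf_action A J)"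
    using lift(1) group_dinf G.group_axioms
    by (simp add: group_action_def group_hom_def group_hom_axioms_def dinf_action_def)
  show "dinf_action A J dinf_a = ?s" "dinf_action A J dinf_b = ?f"
    using lift(2,3) by (simp_all add: dinf_action_def)
qed

lemma finite_index_dinf_rotation:
  assumes H: "finite_index dinf H" 
  shows "\<exists>m. 0 < m \<and> m \<le> card (rcosets\<^bsub>dinf\<^esub> H) \<and> (int m, False) \<in> H"
proof -
  interpret group dinf by (rule group_dinf)
  have sub: "subgroup H dinf" and fin: "finite (rcosets\<^bsub>dinf\<^esub> H)"
    using H by (auto simp: finite_index_def)
  let ?n = "card (rcosets\<^bsub>dinf\<^esub> H)" and ?c = "\<lambda>i :: nat. H #>\<^bsub>dinf\<^esub> (int i, False)"
  have "?c ` {0..?n} \<subseteq> rcosets\<^bsub>dinf\<^esub> H"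
    by (auto simp: RCOSETS_def dinf_simps)
  then have "card (?c ` {0..?n}) \<le> ?n" by (rule card_mono[OF fin])
  then have "card (?c ` {0..?n}) < card {0..?n}" by simp
  then have "\<not> inj_on ?c {0..?n}" by (rule pigeonhole)
  then obtain p q where pq: "p \<le> ?n" "q \<le> ?n" "p \<noteq> q" "?c p = ?c q"
    by (auto simp: inj_on_def)
  obtain i j where ij: "i \<le> ?n" "j \<le> ?n" "i < j" "?c i = ?c j"
    using pq that[of p q] that[of q p] by (cases p q rule: linorder_cases) simp_all
  have "(int j, False) \<in> ?c i"
    using ij(4) rcos_self[OF _ sub, of "(int j, False)"] by (simp add: dinf_simps)
  then obtain h where h: "h \<in> H" "(int j, False) = h \<otimes>\<^bsub>dinf\<^esub> (int i, False)"
    by (auto simp: r_coset_def)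
  then have "h = (int (j - i), False)"
    using ij by (cases h) (auto simp: dinf_simps split: if_splits)
  then show ?thesis using h ij by (intro exI[of _ "j - i"]) auto
qed

lemma finite_dinf_subgroups:
  "finite {H. finite_index dinf H \<and> card (rcosets\<^bsub>dinf\<^esub> H) = n}"
proof -
  interpret group dinf by (rule group_dinf)
  define M where "M = int (fact n)"
  have M: "M > 0" by (simp add: M_def)
  let ?S = "{H. finite_index dinf H \<and> card (rcosets\<^bsub>dinf\<^esub> H) = n}"
  have mem: "(i mod M, e) \<in> H \<longleftrightarrow> (i, e) \<in> H" if H: "H \<in> ?S" for H i e
  proof -
    have sub: "subgroup H dinf" using H by (auto simp: finite_index_def)
    obtain m where m: "0 < m" "m \<le> n" "(int m, False) \<in> H"
      using H finite_index_dinf_rotation[of H] by auto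
    have pow: "(k * int m, False) \<in> H" for k
    proof -
      interpret S: subgroup H dinf by (rule sub)
      have nat: "(int l * int m, False) \<in> H" for l :: nat
      proof (induction l)
        case 0
        then show ?case using S.one_closed by (simp add: dinf_simps)
      next
        case (Suc l)
        then show ?case using S.m_closed[OF m(3) Suc] by (simp add: dinf_simps algebra_simps)
      qed
      have inv: "m_inv dinf (int l * int m, False) = (- int l * int m, False)" for l :: nat
        by (rule inv_equality) (auto simp: dinf_simps)
      show ?thesis
      proof (cases "k \<ge> 0")
        case True then show ?thesis using nat[of "nat k"] by simp
      next
        case False then show ?thesis using S.m_inv_closed[OF nat[of "nat (- k)"]] inv[of "nat (- k)"] by simp
      qed
    qed
    have dvd: "int m dvd M" 
      unfolding M_def int_dvd_int_iff using m by (intro dvd_fact) auto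
    have tr: "(k * M + i, e) \<in> H" if "(i, e) \<in> H" for k i
    proof -
      obtain q where "M = int m * q" using dvd by auto
      then have "(k * M, False) \<in> H" using pow[of "k * q"] by (simp add: algebra_simps)
      from subgroup.m_closed[OF sub this that] show ?thesis by (simp add: dinf_simps)
    qed
    show ?thesis
    proof
      assume "(i mod M, e) \<in> H"
      from tr[OF this, of "i div M"] show "(i, e) \<in> H" by simp
    next
      assume "(i, e) \<in> H"
      moreover have "- (i div M) * M + i = i mod M"
        using div_mult_mod_eq[of i M] by (simp add: algebra_simps)
      ultimately show "(i mod M, e) \<in> H" using tr[of i "- (i div M)"] by simp
    qed
  qed
  have "inj_on (\<lambda>H. H \<inter> ({0..<M} \<times> UNIV)) ?S"
  proof (rule inj_onI)
    fix H K assume HK: "H \<in> ?S" "K \<in> ?S" "H \<inter> ({0..<M} \<times> UNIV) = K \<inter> ({0..<M} \<times> UNIV)"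
    have "(i, e) \<in> H \<longleftrightarrow> (i, e) \<in> K" for i e
    proof -
      have "(i mod M, e) \<in> {0..<M} \<times> UNIV" using M by auto
      then have "(i mod M, e) \<in> H \<longleftrightarrow> (i mod M, e) \<in> K" using HK(3) by blast
      then show ?thesis using mem[OF HK(1)] mem[OF HK(2)] by simp
    qed
    then show "H = K" by auto
  qed
  moreover have "finite ((\<lambda>H. H \<inter> ({0..<M} \<times> UNIV)) ` ?S)"
    by (rule finite_subset[of _ "Pow ({0..<M} \<times> UNIV)"]) auto
  ultimately show ?thesis by (rule finite_imageD[rotated])
qed

lemma finite_fixed_points_dinf_action:
  assumes A: "flip_pair A J" and H: "finite_index dinf H"
  shows "finite (fixed_points (dinf_action A J) (markov_shift A) H)"
proof -
  let ?X = "markov_shift A" and ?\<alpha> = "dinf_action A J"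
  interpret act: group_action dinf ?X ?\<alpha> by (rule group_action_dinf_action(1)[OF A])
  obtain m where m: "0 < m" "(int m, False) \<in> H"
    using finite_index_dinf_rotation[OF H] by auto
  have rot: "?\<alpha> (int k, False) x = (\<lambda>i. x (i + int k))" if x: "x \<in> ?X" for k x
  proof (induction k)
    case 0
    then show ?case using fun_cong[OF act.id_eq_one, of x] x by (simp add: dinf_simps)
  next
    case (Suc k)
    have X: "?\<alpha> (int k, False) x \<in> ?X"
      using act.element_image[of "(int k, False)" x] x by (simp add: dinf_simps)
    have "(int (Suc k), False) = dinf_a \<otimes>\<^bsub>dinf\<^esub> (int k, False)"
      by (simp add: dinf_simps dinf_a_def)
    then have "?\<alpha> (int (Suc k), False) x = ?\<alpha> dinf_a (?\<alpha> (int k, False) x)"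
      using act.composition_rule[OF x, of dinf_a "(int k, False)"] by (simp add: dinf_simps)
    also have "\<dots> = (\<lambda>i. x (i + 1 + int k))"
      using X Suc group_action_dinf_action(2)[OF A] by (simp add: shift_map_def)
    finally show ?case by (simp add: algebra_simps)
  qed
  let ?F = "fixed_points ?\<alpha> ?X H" and ?r = "\<lambda>x :: int \<Rightarrow> nat. restrict x {0..<int m}"
  have per: "x i = x (i mod int m)" if x: "x \<in> ?F" for x i
  proof -
    have step: "x (i + int m) = x i" for i
    proof -
      have "x \<in> ?X" "?\<alpha> (int m, False) x = x" using x m by (auto simp: fixed_points_def)
      then have "(\<lambda>i. x (i + int m)) = x" using rot[of x m] by simp
      then show ?thesis by (rule fun_cong)
    qed
    have n: "x (i + int k * int m) = x i" for k i
    proof (induction k)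
      case (Suc k)
      then show ?case using step[of "i + int k * int m"] by (simp add: algebra_simps)
    qed simp
    have z: "x (i + k * int m) = x i" for k i
      using n[of i "nat k"] n[of "i + k * int m" "nat (- k)"] by (cases "k \<ge> 0") auto
    show ?thesis using z[of "i mod int m" "i div int m"] by (simp add: add.commute)
  qed
  have "inj_on ?r ?F"
  proof (rule inj_onI)
    fix x y assume xy: "x \<in> ?F" "y \<in> ?F" "?r x = ?r y"
    have "x (i mod int m) = y (i mod int m)" for i
      using fun_cong[OF xy(3), of "i mod int m"] m by simp
    then show "x = y" using per[OF xy(1)] per[OF xy(2)] by (auto simp: fun_eq_iff)
  qed
  moreover have "finite (?r ` ?F)"
  proof (rule finite_subset)
    show "?r ` ?F \<subseteq> {0..<int m} \<rightarrow>\<^sub>E {..<dim_row A}"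
      by (auto simp: fixed_points_def markov_shift_def)
  qed (simp add: finite_PiE)
  ultimately show ?thesis by (rule finite_imageD[rotated])
qed

end

theory Submission
  imports Defs
begin

text \<open>
  (a) On the full 2-shift the all-ones matrix \<open>R\<close> is a lag 2 equivalence between any two flips, since
  \<open>R\<close> absorbs permutation matrices; but the identity fixes a symbol and the transposition does not,
  so the subgroup of index 1 sees a difference.

  (b) Take two \<open>\<sigma>\<close>-cycles of length 2, and let \<open>\<phi>\<close> be the identity on both, respectively the identity
  on one and \<open>\<sigma>\<close> on the other. On the second cycle the two actions differ by the automorphism
  \<open>a \<mapsto> a, b \<mapsto> ab\<close> of \<open>D\<^sub>\<infinity>\<close>, which permutes the subgroups of each index, so the zeta functions agree.
  An equivalence would give \<open>K B\<^sup>l = R\<^sup>T R\<close>, where a vanishing diagonal entry forces a vanishing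
  column of \<open>R\<close>, and this contradicts the invertibility of \<open>B\<^sup>l = S R\<close>.
\<close>

section \<open>Zero-one matrices given by relations\<close>

text \<open>Both matrices of a flip pair take this shape; the flip is the graph
  \<open>f i = j\<close> of an involution \<open>f\<close> of the symbols.\<close>

definition rel_mat :: "nat \<Rightarrow> (nat \<Rightarrow> nat \<Rightarrow> bool) \<Rightarrow> nat mat" where
  "rel_mat n P = mat n n (\<lambda>(i, j). of_bool (P i j))"

lemma rel_mat_simps [simp]:
  "dim_row (rel_mat n P) = n" "dim_col (rel_mat n P) = n"
  "rel_mat n P \<in> carrier_mat n n"
  "i < n \<Longrightarrow> j < n \<Longrightarrow> rel_mat n P $$ (i, j) = of_bool (P i j)"
  by (simp_all add: rel_mat_def)

lemma rel_mat_eq: "rel_mat n (=) = 1\<^sub>m n"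
  by (rule eq_matI) auto

lemma mult_mat_index:
  assumes "M \<in> carrier_mat n m" "N \<in> carrier_mat m k" "i < n" "j < k"
  shows "(M * N) $$ (i, j) = (\<Sum>l<m. M $$ (i, l) * N $$ (l, j))"
  using assms by (auto simp: scalar_prod_def lessThan_atLeast0 intro!: sum.cong)

lemma mult_fun_rel_mat_index:
  assumes "M \<in> carrier_mat n m" "i < n" "j < m" "f i < n"
  shows "(rel_mat n (\<lambda>i j. f i = j) * M) $$ (i, j) = M $$ (f i, j)"
proof -
  have "(rel_mat n (\<lambda>i j. f i = j) * M) $$ (i, j) = (\<Sum>l<n. if f i = l then M $$ (l, j) else 0)"
    using assms by (subst mult_mat_index[of _ n n _ m]) (auto intro!: sum.cong)
  then show ?thesis using assms by simp
qed

text \<open>Since \<open>f\<close> is its own inverse, the entries at \<open>(i, j)\<close> of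
  \<open>J * A\<close> and \<open>transpose_mat A * J\<close> are \<open>P (f i) j\<close> and
  \<open>P (f j) i\<close>. The condition on \<open>P\<close> is thus the flip relation read
  entrywise.\<close>

lemma flip_pair_rel_mat:
  assumes f: "\<And>i. i < n \<Longrightarrow> f i < n" "\<And>i. i < n \<Longrightarrow> f (f i) = i"
    and P: "\<And>i j. i < n \<Longrightarrow> j < n \<Longrightarrow> P (f i) j \<longleftrightarrow> P (f j) i"
  shows "flip_pair (rel_mat n P) (rel_mat n (\<lambda>i j. f i = j))"
proof -
  let ?A = "rel_mat n P" and ?J = "rel_mat n (\<lambda>i j. f i = j)"
  have f_iff: "f i = j \<longleftrightarrow> i = f j" if "i < n" "j < n" for i j
    using f that by metis
  have "?J * ?A = transpose_mat ?A * ?J"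
  proof (rule eq_matI)
    fix i j assume "i < dim_row (transpose_mat ?A * ?J)" "j < dim_col (transpose_mat ?A * ?J)"
    then have ij: "i < n" "j < n" by auto
    have "(transpose_mat ?A * ?J) $$ (i, j) = (\<Sum>l<n. if l = f j then of_bool (P l i) else 0)"
      using ij f f_iff by (subst mult_mat_index[of _ n n _ n]) (auto intro!: sum.cong)
    also have "\<dots> = of_bool (P (f j) i)" using ij f by simp
    also have "\<dots> = (?J * ?A) $$ (i, j)"
      using ij f P by (simp add: mult_fun_rel_mat_index[of _ n n] del: index_mult_mat(1))
    finally show "(?J * ?A) $$ (i, j) = (transpose_mat ?A * ?J) $$ (i, j)" ..
  qed auto
  moreover have "?J * ?J = 1\<^sub>m n"
    by (rule eq_matI) (auto simp: mult_fun_rel_mat_index[of _ n n] f simp del: index_mult_mat(1))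
  ultimately show ?thesis
    by (auto simp: flip_pair_def elements_mat_def)
qed

lemma flip_symbol_rel_mat:
  assumes "i < n" "f i < n"
  shows "flip_symbol (rel_mat n (\<lambda>i j. f i = j)) i = f i"
  unfolding flip_symbol_def using assms by (intro the_equality) (auto simp: of_bool_def split: if_splits)

lemma markov_shift_rel_mat:
  "markov_shift (rel_mat n P) = {x. (\<forall>i. x i < n) \<and> (\<forall>i. P (x i) (x (i + 1)))}"
  by (auto simp: markov_shift_def of_bool_def split: if_splits)


section \<open>The Lind zeta function at index one\<close>

lemma (in group) subgroups_of_index_one:
  "{H. finite_index G H \<and> card (rcosets H) = 1} = {carrier G}"
proof (intro equalityI subsetI)
  fix H assume "H \<in> {H. finite_index G H \<and> card (rcosets H) = 1}"
  then have H: "subgroup H G" and "card (rcosets H) = 1"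
    by (auto simp: finite_index_def)
  then obtain C where C: "rcosets H = {C}" by (auto simp: card_1_singleton_iff)
  have "g \<in> H" if g: "g \<in> carrier G" for g
  proof -
    have "H #> g \<in> {C}" "H #> \<one> \<in> {C}"
      using g by (auto simp flip: C simp: RCOSETS_def)
    then have "H #> g = H"
      using H by (simp add: coset_mult_one subgroup.subset)
    then show ?thesis using rcos_self[OF g H] by simp
  qed
  then show "H \<in> {carrier G}" using subgroup.subset[OF H] by auto
next
  fix H assume "H \<in> {carrier G}"
  then have H: "H = carrier G" by simp
  have "rcosets (carrier G) = {carrier G}"
    using coset_join2[OF _ subgroup_self] by (auto simp: RCOSETS_def)
  then show "H \<in> {H. finite_index G H \<and> card (rcosets H) = 1}"
    by (simp add: H finite_index_def subgroup_self)
qed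

text \<open>Only the whole group has index one, and in degree one only the linear term of the
  exponential contributes. This coefficient separates the zeta functions in (a).\<close>

lemma (in group) lind_zeta_nth_1:
  "fps_nth (lind_zeta G \<alpha> X) 1 = of_nat (card (fixed_points \<alpha> X (carrier G)))"
proof -
  have "fps_nth (lind_zeta_exponent G \<alpha> X) 1 = of_nat (card (fixed_points \<alpha> X (carrier G)))"
    using subgroups_of_index_one by (simp add: lind_zeta_exponent_def)
  then show ?thesis
    by (simp add: lind_zeta_def fps_compose_nth)
qed

section \<open>The dihedral action evaluated on normal forms\<close>

lemma dinf_action_eq:
  assumes A: "flip_pair A J" and x: "x \<in> markov_shift A"
  shows "dinf_action A J (i, e) x =
    dinf_action A J (i, False) (if e then flip_map A J x else x)"
proof -
  interpret act: group_action dinf "markov_shift A" "dinf_action A J"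
    by (rule group_action_dinf_action(1)[OF A])
  have "(i, True) = (i, False) \<otimes>\<^bsub>dinf\<^esub> dinf_b"
    by (simp add: dinf_simps dinf_b_def)
  then have "dinf_action A J (i, True) x = dinf_action A J (i, False) (dinf_action A J dinf_b x)"
    using act.composition_rule[OF x, of "(i, False)" dinf_b] by (simp add: dinf_simps)
  then show ?thesis by (simp add: group_action_dinf_action(3)[OF A])
qed

lemma dinf_action_shift:
  assumes A: "flip_pair A J" and x: "x \<in> markov_shift A"
  shows "dinf_action A J (i, False) (shift_map A x) = dinf_action A J (i + 1, False) x"
proof -
  interpret act: group_action dinf "markov_shift A" "dinf_action A J"
    by (rule group_action_dinf_action(1)[OF A])
  have "(i + 1, False) = (i, False) \<otimes>\<^bsub>dinf\<^esub> dinf_a"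
    by (simp add: dinf_simps dinf_a_def)
  then show ?thesis
    using act.composition_rule[OF x, of "(i, False)" dinf_a]
    by (simp add: dinf_simps group_action_dinf_action(2)[OF A])
qed

text \<open>Powers of a involve the shift alone, so two flips on the same chain share them and
  differ only in how b acts.\<close>

lemma dinf_action_rotation:
  "dinf_action A J (i, False) = dinf_action A K (i, False)"
  by (simp add: dinf_action_def dinf_lift_def)

text \<open>As a and b generate the group, a point fixed by both is fixed by every
  \<open>(i, e)\<close>.\<close>

lemma markov_lind_zeta_nth_1:
  assumes "flip_pair A J"
  shows "fps_nth (markov_lind_zeta A J) 1 =
    of_nat (card {x \<in> markov_shift A. shift_map A x = x \<and> flip_map A J x = x})"
proof -
  let ?\<alpha> = "dinf_action A J" and ?X = "markov_shift A"
  interpret act: group_action dinf ?X ?\<alpha>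
    by (rule group_action_dinf_action(1)[OF assms])
  have "fixed_points ?\<alpha> ?X (carrier dinf) = {x \<in> ?X. shift_map A x = x \<and> flip_map A J x = x}"
  proof (intro equalityI subsetI)
    fix x assume "x \<in> fixed_points ?\<alpha> ?X (carrier dinf)"
    then have "x \<in> ?X" "?\<alpha> dinf_a x = x" "?\<alpha> dinf_b x = x"
      by (auto simp: fixed_points_def dinf_simps)
    then show "x \<in> {x \<in> ?X. shift_map A x = x \<and> flip_map A J x = x}"
      by (simp add: group_action_dinf_action(2,3)[OF assms])
  next
    fix x assume "x \<in> {x \<in> ?X. shift_map A x = x \<and> flip_map A J x = x}"
    then have x: "x \<in> ?X" "shift_map A x = x" "flip_map A J x = x" by auto
    have rot_step: "?\<alpha> (i + 1, False) x = ?\<alpha> (i, False) x" for i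
      using dinf_action_shift[OF assms x(1), of i] unfolding x(2) ..
    have rot: "?\<alpha> (i, False) x = x" for i :: int
    proof (induction i rule: int_induct[where k = 0])
      case base
      then show ?case using fun_cong[OF act.id_eq_one, of x] x by (simp add: dinf_simps)
    next
      case (step1 i)
      then show ?case by (simp add: rot_step)
    next
      case (step2 i)
      then show ?case using rot_step[of "i - 1"] by (metis diff_add_cancel)
    qed
    have "?\<alpha> (i, e) x = x" for i e
      using dinf_action_eq[OF assms x(1), of i e] rot x by simp
    then show "x \<in> fixed_points ?\<alpha> ?X (carrier dinf)"
      using x by (auto simp: fixed_points_def)
  qed
  then show ?thesis
    using group.lind_zeta_nth_1[OF group_dinf, of ?\<alpha> ?X] by (simp add: markov_lind_zeta_def)
qed


section \<open>Invariance under automorphisms of the group\<close>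

lemma finite_index_hom_image:
  assumes G: "group G" and hom: "\<theta> \<in> hom G G" and bij: "bij_betw \<theta> (carrier G) (carrier G)"
    and H: "finite_index G H"
  shows "finite_index G (\<theta> ` H)" and "card (rcosets\<^bsub>G\<^esub> (\<theta> ` H)) = card (rcosets\<^bsub>G\<^esub> H)"
proof -
  interpret group_hom G G \<theta>
    using G hom by (simp add: group_hom_def group_hom_axioms_def)
  have sub: "subgroup H G" and fin: "finite (rcosets\<^bsub>G\<^esub> H)"
    using H by (auto simp: finite_index_def)
  have HG: "H \<subseteq> carrier G" using sub by (rule subgroup.subset)
  have surj: "\<theta> ` carrier G = carrier G" and inj: "inj_on \<theta> (carrier G)"
    using bij by (auto simp: bij_betw_def)
  have coset: "\<theta> ` (H #>\<^bsub>G\<^esub> g) = \<theta> ` H #>\<^bsub>G\<^esub> \<theta> g" if "g \<in> carrier G" for g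
    using that HG by (force simp: r_coset_def)
  have eq: "rcosets\<^bsub>G\<^esub> (\<theta> ` H) = (`) \<theta> ` (rcosets\<^bsub>G\<^esub> H)"
  proof -
    have "rcosets\<^bsub>G\<^esub> (\<theta> ` H) = (\<lambda>g. \<theta> ` H #>\<^bsub>G\<^esub> g) ` \<theta> ` carrier G"
      by (auto simp: RCOSETS_def surj)
    also have "\<dots> = (`) \<theta> ` (\<lambda>g. H #>\<^bsub>G\<^esub> g) ` carrier G"
      unfolding image_image using coset by (auto intro!: image_cong)
    finally show ?thesis by (auto simp: RCOSETS_def)
  qed
  have "inj_on ((`) \<theta>) (rcosets\<^bsub>G\<^esub> H)"
    using inj_on_image_Pow[OF inj] G.rcosets_subset_PowG[OF sub] by (rule inj_on_subset)
  then show "card (rcosets\<^bsub>G\<^esub> (\<theta> ` H)) = card (rcosets\<^bsub>G\<^esub> H)"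
    unfolding eq by (rule card_image)
  show "finite_index G (\<theta> ` H)"
    using subgroup_img_is_subgroup[OF sub] fin by (simp add: finite_index_def eq)
qed

text \<open>An automorphism permutes the subgroups of index \<open>n\<close>; the inverse
  automorphism undoes the permutation.\<close>

lemma sum_finite_index_reindex:
  assumes G: "group G" and hom: "\<theta> \<in> hom G G" and bij: "bij_betw \<theta> (carrier G) (carrier G)"
  shows "(\<Sum>H | finite_index G H \<and> card (rcosets\<^bsub>G\<^esub> H) = n. F (\<theta> ` H)) =
         (\<Sum>H | finite_index G H \<and> card (rcosets\<^bsub>G\<^esub> H) = n. F H)"
proof -
  let ?S = "{H. finite_index G H \<and> card (rcosets\<^bsub>G\<^esub> H) = n}"
  let ?\<theta>' = "inv_into (carrier G) \<theta>"
  have hom': "?\<theta>' \<in> hom G G"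
    using G hom bij by (metis group.iso_set_sym isoI iso_imp_homomorphism)
  have bij': "bij_betw ?\<theta>' (carrier G) (carrier G)"
    using bij by (rule bij_betw_inv_into)
  have sub: "H \<subseteq> carrier G" if "H \<in> ?S" for H
    using that by (auto simp: finite_index_def dest: subgroup.subset)
  have surj: "\<theta> ` carrier G = carrier G" and inj: "inj_on \<theta> (carrier G)"
    using bij by (auto simp: bij_betw_def)
  show ?thesis
  proof (rule sum.reindex_bij_witness[where i = "\<lambda>H. ?\<theta>' ` H" and j = "\<lambda>H. \<theta> ` H"])
    fix H assume H: "H \<in> ?S"
    show "?\<theta>' ` \<theta> ` H = H"
      using inv_into_image_cancel[OF inj sub[OF H]] .
    show "\<theta> ` ?\<theta>' ` H = H"
      using image_inv_into_cancel[OF surj sub[OF H]] .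
    show "\<theta> ` H \<in> ?S"
      using finite_index_hom_image[OF G hom bij] H by auto
    show "?\<theta>' ` H \<in> ?S"
      using finite_index_hom_image[OF G hom' bij'] H by auto
  qed simp
qed

text \<open>
  The two actions may differ by an automorphism on a part \<open>Y\<close> of the space only, and still the
  exponents agree, because each of them is additive in the space.
\<close>

lemma lind_zeta_partial_twist:
  fixes G :: "('g, 'm) monoid_scheme" and \<alpha> \<beta> :: "'g \<Rightarrow> 'x \<Rightarrow> 'x"
  assumes G: "group G" and hom: "\<theta> \<in> hom G G" and bij: "bij_betw \<theta> (carrier G) (carrier G)"
    and fin: "\<And>H. finite_index G H \<Longrightarrow> finite (fixed_points \<alpha> X H)"
             "\<And>H. finite_index G H \<Longrightarrow> finite (fixed_points \<beta> X H)"
    and Y: "\<And>g x. g \<in> carrier G \<Longrightarrow> x \<in> X \<Longrightarrow> x \<in> Y \<Longrightarrow> \<beta> g x = \<alpha> (\<theta> g) x"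
    and nY: "\<And>g x. g \<in> carrier G \<Longrightarrow> x \<in> X \<Longrightarrow> x \<notin> Y \<Longrightarrow> \<beta> g x = \<alpha> g x"
  shows "lind_zeta G \<alpha> X = lind_zeta G \<beta> X"
proof -
  let ?f = "\<lambda>\<gamma> H. card (fixed_points \<gamma> (X - Y) H)" and ?g = "\<lambda>\<gamma> H. card (fixed_points \<gamma> (X \<inter> Y) H)"
  let ?S = "\<lambda>n. {H. finite_index G H \<and> card (rcosets\<^bsub>G\<^esub> H) = n}"
  \<comment> \<open>Finiteness matters here: \<open>card\<close> is 0 on infinite sets and would not
    be additive.\<close>
  have split: "card (fixed_points \<gamma> X H) = ?f \<gamma> H + ?g \<gamma> H"
    if "finite (fixed_points \<gamma> X H)" for \<gamma> :: "'g \<Rightarrow> 'x \<Rightarrow> 'x" and H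
  proof -
    have "fixed_points \<gamma> X H = fixed_points \<gamma> (X - Y) H \<union> fixed_points \<gamma> (X \<inter> Y) H"
      by (auto simp: fixed_points_def)
    moreover have "fixed_points \<gamma> (X - Y) H \<inter> fixed_points \<gamma> (X \<inter> Y) H = {}"
      by (auto simp: fixed_points_def)
    ultimately show ?thesis using that by (metis card_Un_disjoint finite_Un)
  qed
  have "(\<Sum>H\<in>?S n. card (fixed_points \<alpha> X H)) = (\<Sum>H\<in>?S n. card (fixed_points \<beta> X H))" for n
  proof -
    have tw: "?f \<beta> H = ?f \<alpha> H \<and> ?g \<beta> H = ?g \<alpha> (\<theta> ` H)" if "H \<in> ?S n" for H
    proof -
      have "H \<subseteq> carrier G"
        using that by (auto simp: finite_index_def dest: subgroup.subset)
      then have "fixed_points \<beta> (X - Y) H = fixed_points \<alpha> (X - Y) H"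
        "fixed_points \<beta> (X \<inter> Y) H = fixed_points \<alpha> (X \<inter> Y) (\<theta> ` H)"
        using Y nY by (auto simp: fixed_points_def subset_iff)
      then show ?thesis by simp
    qed
    have "(\<Sum>H\<in>?S n. card (fixed_points \<beta> X H)) = (\<Sum>H\<in>?S n. ?f \<alpha> H) + (\<Sum>H\<in>?S n. ?g \<alpha> (\<theta> ` H))"
      unfolding sum.distrib[symmetric] using split fin(2) tw by (intro sum.cong) auto
    also have "(\<Sum>H\<in>?S n. ?g \<alpha> (\<theta> ` H)) = (\<Sum>H\<in>?S n. ?g \<alpha> H)"
      by (rule sum_finite_index_reindex[OF G hom bij])
    also have "(\<Sum>H\<in>?S n. ?f \<alpha> H) + \<dots> = (\<Sum>H\<in>?S n. card (fixed_points \<alpha> X H))"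
      unfolding sum.distrib[symmetric] using split fin(1) by (intro sum.cong) auto
    finally show ?thesis ..
  qed
  then have "(\<Sum>H\<in>?S n. of_nat (card (fixed_points \<alpha> X H)) / of_nat n :: rat) =
    (\<Sum>H\<in>?S n. of_nat (card (fixed_points \<beta> X H)) / of_nat n)" for n
    by (simp flip: sum_divide_distrib of_nat_sum)
  then show ?thesis
    by (simp add: lind_zeta_def lind_zeta_exponent_def)
qed

text \<open>The automorphism with a to a and b to ab, on normal forms: a^i b goes to a^i ab =
  a^(i+1) b.\<close>

definition dinf_twist :: "int \<times> bool \<Rightarrow> int \<times> bool" where
  "dinf_twist = (\<lambda>(i, e). (if e then i + 1 else i, e))"

lemma dinf_twist_hom: "dinf_twist \<in> hom dinf dinf"
  by (rule homI) (auto simp: dinf_twist_def dinf_simps split: prod.splits)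

lemma dinf_twist_bij: "bij_betw dinf_twist (carrier dinf) (carrier dinf)"
  by (rule bij_betwI[where g = "\<lambda>(i, e). (if e then i - 1 else i, e)"])
     (auto simp: dinf_twist_def dinf_simps)

text \<open>On \<open>Y\<close> the element b acts through \<open>K\<close> as ab does through
  \<open>J\<close>. As the powers of a act alike, this comparison of the flips extends to every
  normal form a^i b.\<close>

lemma markov_lind_zeta_partial_twist:
  assumes J: "flip_pair A J" and K: "flip_pair A K"
    and Y: "\<And>x. x \<in> markov_shift A \<Longrightarrow> x \<in> Y \<Longrightarrow> flip_map A K x = shift_map A (flip_map A J x)"
    and nY: "\<And>x. x \<in> markov_shift A \<Longrightarrow> x \<notin> Y \<Longrightarrow> flip_map A K x = flip_map A J x"
  shows "markov_lind_zeta A J = markov_lind_zeta A K"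
  unfolding markov_lind_zeta_def
proof (rule lind_zeta_partial_twist[OF group_dinf dinf_twist_hom dinf_twist_bij, where Y = Y])
  fix g :: "int \<times> bool" and x assume x: "x \<in> markov_shift A"
  obtain i e where g: "g = (i, e)" by (cases g)
  have rot: "dinf_action A K (j, False) = dinf_action A J (j, False)" for j
    by (rule dinf_action_rotation)
  show "dinf_action A K g x = dinf_action A J (dinf_twist g) x" if "x \<in> Y"
    using Y[OF x that] dinf_action_shift[OF J flip_map_closed[OF J x], of i]
      dinf_action_eq[OF J x, of "i + 1" e] dinf_action_eq[OF K x, of i e]
    by (cases e) (simp_all add: g rot dinf_twist_def)
  show "dinf_action A K g x = dinf_action A J g x" if "x \<notin> Y"
    using nY[OF x that] dinf_action_eq[OF J x, of i e] dinf_action_eq[OF K x, of i e]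
    by (cases e) (simp_all add: g rot)
qed (use finite_fixed_points_dinf_action J K in auto)


section \<open>Equivalent flips with different zeta functions\<close>

definition full_mat :: "nat \<Rightarrow> nat mat" where
  "full_mat n = rel_mat n (\<lambda>_ _. True)"

lemma flip_pair_full_mat:
  assumes "\<And>i. i < n \<Longrightarrow> f i < n" "\<And>i. i < n \<Longrightarrow> f (f i) = i"
  shows "flip_pair (full_mat n) (rel_mat n (\<lambda>i j. f i = j))"
  unfolding full_mat_def by (rule flip_pair_rel_mat) (use assms in auto)

text \<open>Each row of \<open>J\<close> has exactly one 1, so \<open>J\<close> on the left leaves
  the all-ones matrix alone. The other side follows from the flip relation, the all-ones matrix
  being symmetric.\<close>

lemma full_mat_absorb:
  assumes "flip_pair (full_mat n) J"
  shows "full_mat n * J = full_mat n" "J * full_mat n = full_mat n"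
proof -
  have J: "J \<in> carrier_mat n n" and comm: "J * full_mat n = transpose_mat (full_mat n) * J"
    using assms by (auto simp: flip_pair_def full_mat_def)
  have t: "transpose_mat (full_mat n) = full_mat n"
    by (rule eq_matI) (auto simp: full_mat_def)
  show *: "J * full_mat n = full_mat n"
  proof (rule eq_matI)
    fix i j assume "i < dim_row (full_mat n)" "j < dim_col (full_mat n)"
    then have ij: "i < n" "j < n" by (auto simp: full_mat_def)
    have "(J * full_mat n) $$ (i, j) = (\<Sum>l<n. if l = flip_symbol J i then 1 else 0)"
      using ij J flip_pair_symbol(3)[OF assms, of i]
      by (subst mult_mat_index[OF J]) (auto simp: full_mat_def intro!: sum.cong)
    also have "\<dots> = full_mat n $$ (i, j)"
      using ij flip_pair_symbol(2)[OF assms, of i] by (simp add: full_mat_def)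
    finally show "(J * full_mat n) $$ (i, j) = full_mat n $$ (i, j)" .
  qed (use J in \<open>auto simp: full_mat_def\<close>)
  then show "full_mat n * J = full_mat n" using comm t by simp
qed

lemma full_mat_shift_equivalent:
  assumes J: "flip_pair (full_mat n) J" and K: "flip_pair (full_mat n) K"
  shows "dinf_shift_equivalent (full_mat n) J (full_mat n) K"
proof -
  let ?E = "full_mat n"
  have E: "?E \<in> carrier_mat n n" by (simp add: full_mat_def)
  have "transpose_mat ?E = ?E"
    by (rule eq_matI) (auto simp: full_mat_def)
  then have "K * transpose_mat ?E * J = ?E"
    using full_mat_absorb[OF J] full_mat_absorb[OF K] by simp
  moreover have "?E ^\<^sub>m 2 = ?E * ?E"
    using E by (simp add: numeral_2_eq_2)
  \<comment> \<open>With \<open>R\<close> and \<open>S\<close> both equal to \<open>?E\<close>, the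
    products \<open>R * S\<close> and \<open>S * R\<close> are the square of \<open>?E\<close>,
    whence the lag 2.\<close>
  ultimately have "dinf_shift_equivalence 2 ?E J ?E K ?E ?E"
    using E by (simp add: dinf_shift_equivalence_def)
  then show ?thesis by (auto simp: dinf_shift_equivalent_def)
qed

lemma full_mat_zeta_neq:
  assumes f: "\<And>i. i < n \<Longrightarrow> f i < n" "\<And>i. i < n \<Longrightarrow> f (f i) = i" "\<And>i. i < n \<Longrightarrow> f i \<noteq> i"
    and n: "0 < n"
  shows "markov_lind_zeta (full_mat n) (rel_mat n (=)) \<noteq>
         markov_lind_zeta (full_mat n) (rel_mat n (\<lambda>i j. f i = j))"
proof -
  let ?E = "full_mat n" and ?J = "rel_mat n (=)" and ?K = "rel_mat n (\<lambda>i j. f i = j)"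
  have J: "flip_pair ?E ?J" using flip_pair_full_mat[of n "\<lambda>i. i"] by simp
  have K: "flip_pair ?E ?K" using f by (intro flip_pair_full_mat)
  have X: "markov_shift ?E = {x. \<forall>i. x i < n}"
    by (simp add: full_mat_def markov_shift_rel_mat)
  let ?F = "\<lambda>J. {x \<in> markov_shift ?E. shift_map ?E x = x \<and> flip_map ?E J x = x}"
  have "?F ?K = {}"
  proof (intro equals0I)
    fix x assume "x \<in> ?F ?K"
    \<comment> \<open>Reversal fixes coordinate 0, so the flip acts there by \<open>f\<close>
      alone.\<close>
    then have x: "x \<in> markov_shift ?E" "flip_map ?E ?K x 0 = x 0" by auto
    then have "flip_symbol ?K (x 0) = x 0" by (simp add: flip_map_apply)
    moreover have "x 0 < n" using x X by simp
    ultimately show False using f flip_symbol_rel_mat[of "x 0" n f] by simp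
  qed
  then have "fps_nth (markov_lind_zeta ?E ?K) 1 = 0"
    using markov_lind_zeta_nth_1[OF K] by (metis card.empty of_nat_0)
  moreover have "?F ?J \<noteq> {}"
  proof -
    have "(\<lambda>_. 0) \<in> ?F ?J"
      using n X flip_symbol_rel_mat[of 0 n "\<lambda>i. i"] by (auto simp: shift_map_def flip_map_def)
    then show ?thesis by blast
  qed
  \<comment> \<open>Nonemptiness gives a nonzero \<open>card\<close> only for a finite set.
    Shift-invariant points are constant sequences, hence at most \<open>n\<close> in number.\<close>
  moreover have "finite (?F ?J)"
  proof -
    have "?F ?J \<subseteq> (\<lambda>c _. c) ` {..<n}"
    proof
      fix x assume x: "x \<in> ?F ?J"
      then have "x (i + 1) = x i" for i
        using shift_map_apply[of x ?E i] by simp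
      then have s: "x i = x 0" for i
        by (induction i rule: int_induct[where k = 0]) (auto, metis diff_add_cancel)
      then have "x = (\<lambda>_. x 0)" by auto
      moreover have "x 0 < n" using x X by simp
      ultimately show "x \<in> (\<lambda>c _. c) ` {..<n}" by blast
    qed
    then show ?thesis by (rule finite_subset) simp
  qed
  then have "card (?F ?J) = 0 \<longleftrightarrow> ?F ?J = {}" by (rule card_0_eq)
  ultimately have "fps_nth (markov_lind_zeta ?E ?J) 1 \<noteq> fps_nth (markov_lind_zeta ?E ?K) 1"
    using markov_lind_zeta_nth_1[OF J] by simp
  then show ?thesis by metis
qed


section \<open>Inequivalent flips with equal zeta functions\<close>

text \<open>On the symbols below 4 the cycles are {0, 1} and {2, 3}. Defining the swap on all
  naturals makes it an involution without any bound.\<close>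

definition swap_adj :: "nat \<Rightarrow> nat" where
  "swap_adj i = (if even i then i + 1 else i - 1)"

definition half_swap :: "nat \<Rightarrow> nat" where
  "half_swap i = (if i < 2 then i else swap_adj i)"

definition two_cycles :: "nat mat" where
  "two_cycles = rel_mat 4 (\<lambda>i j. swap_adj i = j)"

abbreviation half_flip :: "nat mat" where
  "half_flip \<equiv> rel_mat 4 (\<lambda>i j. half_swap i = j)"

lemma swap_adj_swap_adj: "swap_adj (swap_adj i) = i"
  by (auto simp: swap_adj_def)

lemma swap_adj_less_2: "swap_adj i < 2 \<longleftrightarrow> i < 2"
  by (auto simp: swap_adj_def less_2_cases_iff elim!: oddE evenE)

lemma swap_adj_less_4: "i < 4 \<Longrightarrow> swap_adj i < 4"
  by (auto simp: swap_adj_def elim!: evenE)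

lemma half_swap_half_swap: "half_swap (half_swap i) = i"
  by (simp add: half_swap_def swap_adj_swap_adj swap_adj_less_2)

lemma half_swap_less_4: "i < 4 \<Longrightarrow> half_swap i < 4"
  by (simp add: half_swap_def swap_adj_less_4)

text \<open>\<open>swap_adj\<close> and \<open>half_swap\<close> are commuting involutions, so their
  composite is an involution and its graph is symmetric, which is the flip relation.\<close>

lemma flip_pair_two_cycles:
  "flip_pair two_cycles (rel_mat 4 (=))" "flip_pair two_cycles half_flip"
proof -
  show "flip_pair two_cycles half_flip"
    unfolding two_cycles_def
  proof (rule flip_pair_rel_mat)
    fix i j
    have "swap_adj (half_swap k) = half_swap (swap_adj k)" for k
      by (simp add: half_swap_def swap_adj_less_2)
    then show "swap_adj (half_swap i) = j \<longleftrightarrow> swap_adj (half_swap j) = i"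
      using swap_adj_swap_adj half_swap_half_swap by metis
  qed (simp_all add: half_swap_half_swap half_swap_less_4)
  have "swap_adj i = j \<longleftrightarrow> swap_adj j = i" for i j
    using swap_adj_swap_adj by metis
  then show "flip_pair two_cycles (rel_mat 4 (=))"
    unfolding two_cycles_def
    by (intro flip_pair_rel_mat[where f = "\<lambda>i. i"]) (assumption | rule refl)+
qed

lemma two_cycles_zeta_eq:
  "markov_lind_zeta two_cycles (rel_mat 4 (=)) = markov_lind_zeta two_cycles half_flip"
proof (rule markov_lind_zeta_partial_twist[OF flip_pair_two_cycles, where Y = "{x. \<not> x 0 < 2}"])
  fix x assume x: "x \<in> markov_shift two_cycles"
  have x4: "x i < 4" and step: "x (i + 1) = swap_adj (x i)" for i
    using x by (auto simp: two_cycles_def markov_shift_rel_mat)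
  \<comment> \<open>A point never leaves its cycle, so coordinate 0 decides which one it lies
    on.\<close>
  have block: "x i < 2 \<longleftrightarrow> x 0 < 2" for i
  proof (induction i rule: int_induct[where k = 0])
    case (step2 i)
    then show ?case using step[of "i - 1"] swap_adj_less_2 by simp
  qed (simp_all add: step swap_adj_less_2)
  have J: "flip_map two_cycles (rel_mat 4 (=)) x i = x (- i)" for i
    using flip_symbol_rel_mat[of _ 4 "\<lambda>i. i"] x4 x by (simp add: flip_map_apply)
  have K: "flip_map two_cycles half_flip x i = half_swap (x (- i))" for i
    using x x4 by (simp add: flip_map_apply flip_symbol_rel_mat half_swap_less_4)
  show "flip_map two_cycles half_flip x =
    shift_map two_cycles (flip_map two_cycles (rel_mat 4 (=)) x)" if "x \<in> {x. \<not> x 0 < 2}"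
  proof
    fix i
    \<comment> \<open>On a 2-cycle predecessor and successor coincide, so swapping
      \<open>x (- i)\<close> gives coordinate \<open>i + 1\<close> of the reversed point; this is
      the extra shift.\<close>
    have "x (- i - 1) = swap_adj (x (- i))"
      using step[of "- i - 1"] by (simp add: swap_adj_swap_adj)
    then show "flip_map two_cycles half_flip x i =
      shift_map two_cycles (flip_map two_cycles (rel_mat 4 (=)) x) i"
      using that block[of "- i"] flip_map_closed[OF flip_pair_two_cycles(1) x]
      unfolding K by (simp add: J shift_map_apply half_swap_def)
  qed
  show "flip_map two_cycles half_flip x = flip_map two_cycles (rel_mat 4 (=)) x"
    if "x \<notin> {x. \<not> x 0 < 2}"
    proof
    fix i
    show "flip_map two_cycles half_flip x i = flip_map two_cycles (rel_mat 4 (=)) x i"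
      unfolding K J using that block[of "- i"] by (simp add: half_swap_def)
  qed
qed

lemma two_cycles_pow:
  "two_cycles ^\<^sub>m l = (if even l then 1\<^sub>m 4 else two_cycles)"
proof (induction l)
  case (Suc l)
  have "two_cycles * two_cycles = 1\<^sub>m 4"
    by (rule eq_matI)
       (auto simp: two_cycles_def mult_fun_rel_mat_index[of _ 4 4] swap_adj_less_4 swap_adj_swap_adj
         simp del: index_mult_mat(1))
  then show ?case
    using Suc by (simp add: two_cycles_def)
qed (simp add: two_cycles_def)

text \<open>Each cycle rules out one parity of the lag: even lags fail on {2, 3}, where
  \<open>half_swap\<close> exchanges the symbols, and odd lags on {0, 1}, where it fixes
  them.\<close>

lemma two_cycles_not_equivalent:
  "\<not> dinf_shift_equivalent two_cycles (rel_mat 4 (=)) two_cycles half_flip"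
proof
  assume "dinf_shift_equivalent two_cycles (rel_mat 4 (=)) two_cycles half_flip"
  then obtain l R S where R: "R \<in> carrier_mat 4 4" and S: "S \<in> carrier_mat 4 4"
    and SR: "two_cycles ^\<^sub>m l = S * R" and SK: "S = half_flip * transpose_mat R"
    by (auto simp: dinf_shift_equivalent_def dinf_shift_equivalence_def rel_mat_eq two_cycles_def)
  have entry: "(two_cycles ^\<^sub>m l) $$ (i, j) = (\<Sum>k<4. R $$ (k, half_swap i) * R $$ (k, j))"
    if "i < 4" "j < 4" for i j
    unfolding SR using that R half_swap_less_4[of i]
    by (subst mult_mat_index[OF S R]) (auto simp: SK mult_fun_rel_mat_index[of _ 4 4]
        simp del: index_mult_mat(1) intro!: sum.cong)
  \<comment> \<open>The entry at \<open>(i, half_swap i)\<close> is the sum of the squares of column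
    \<open>half_swap i\<close> of \<open>R\<close>. If it is 0, that column vanishes, and with it
    the same column of the power.\<close>
  have column: "(two_cycles ^\<^sub>m l) $$ (j, half_swap i) = 0"
    if "i < 4" "j < 4" "(two_cycles ^\<^sub>m l) $$ (i, half_swap i) = 0" for i j
    using that half_swap_less_4[of i] by (auto simp: entry)
  show False
  proof (cases "even l")
    \<comment> \<open>The identity has entry 0 at \<open>(2, 3)\<close>, which would force its entry
      at \<open>(3, 3)\<close> to be 0.\<close>
    case True
    then show ?thesis
      using column[of 2 3] by (simp add: two_cycles_pow half_swap_def swap_adj_def)
  next
    \<comment> \<open>Here entry \<open>(0, 0)\<close> is 0, which would force entry
      \<open>(1, 0)\<close> to be 0, although 1 is followed by 0.\<close>
    case False
    then have "two_cycles ^\<^sub>m l = rel_mat 4 (\<lambda>i j. swap_adj i = j)"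
      unfolding two_cycles_pow by (simp add: two_cycles_def)
    then show ?thesis
      using column[of 0 1] by (simp add: half_swap_def swap_adj_def)
  qed
qed

theorem theoremB:
  shows "(\<exists>A J B K. flip_pair A J \<and> flip_pair B K \<and>
            dinf_shift_equivalent A J B K \<and> markov_lind_zeta A J \<noteq> markov_lind_zeta B K) \<and>
         (\<exists>A J B K. flip_pair A J \<and> flip_pair B K \<and>
            markov_lind_zeta A J = markov_lind_zeta B K \<and> \<not> dinf_shift_equivalent A J B K)"
proof
  \<comment> \<open>On the symbols 0 and 1 the map \<open>1 - i\<close> is the
    transposition.\<close>
  have f: "flip_pair (full_mat 2) (rel_mat 2 (=))"
    "flip_pair (full_mat 2) (rel_mat 2 (\<lambda>i j. 1 - i = j))"
    using flip_pair_full_mat[of 2 "\<lambda>i. i"] flip_pair_full_mat[of 2 "\<lambda>i. 1 - i"] by auto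
  have "markov_lind_zeta (full_mat 2) (rel_mat 2 (=)) \<noteq>
        markov_lind_zeta (full_mat 2) (rel_mat 2 (\<lambda>i j. 1 - i = j))"
    by (rule full_mat_zeta_neq) (auto simp: less_2_cases_iff)
  then show "\<exists>A J B K. flip_pair A J \<and> flip_pair B K \<and>
      dinf_shift_equivalent A J B K \<and> markov_lind_zeta A J \<noteq> markov_lind_zeta B K"
    using f full_mat_shift_equivalent[OF f] by blast
  show "\<exists>A J B K. flip_pair A J \<and> flip_pair B K \<and>
      markov_lind_zeta A J = markov_lind_zeta B K \<and> \<not> dinf_shift_equivalent A J B K"
    using flip_pair_two_cycles two_cycles_zeta_eq two_cycles_not_equivalent by blast
qed

end
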